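(* Let $m_1$ and $m_2$ be mass functions on frames $\Theta_1$ and $\Theta_2$ respectively, with $k_{1,2}<1$, and let $m_{1,2}$ be their combination according to Dempster's combination rule. Let $Pl_1$, $Pl_2$, $Pl_{1,2}$ denote the plausibility functions of $m_1$, $m_2$, $m_{1,2}$ respectively. If the evidence combination of $m_1$ and $m_2$ satisfies the open-world criterion, i.e. $\Upsilon_{1,2}\neq\emptyset$, then there exists $\omega\in\Theta=\Theta_1\cup\Theta_2$ such that ($Pl_1(\{\omega\})>0$ or $Pl_2(\{\omega\})>0$) but $Pl_{1,2}(\{\omega\})=0$.
   Context: A frame $\Theta$ is a finite set of mutually exclusive and exhaustive elements. A mass function on $\Theta$ is a map $m:2^\Theta\to[0,1]$ with $m(\emptyset)=0$ and $\sum_{A\subseteq\Theta}m(A)=1$. A focal element of $m$ is a subset $A\subseteq\Theta$ with $m(A)>0$. The plausibility function is $Pl(A)=\sum_{B\cap A\neq\emptyset}m(B)$; $Pl(\omega)$ means $Pl(\{\omega\})$. Mass functions on different frames $\Theta_1,\Theta_2$ are regarded as set functions on subsets of $\Theta_1\cup\Theta_2$ (zero on sets not contained in the respective frame). Dempster's combination rule: with $k_{1,2}=\sum_{A\cap B=\emptyset}m_1(A)m_2(B)$ and provided $k_{1,2}<1$, the combination is $m_{1,2}(\emptyset)=0$ and $m_{1,2}(x)=\frac{1}{1-k_{1,2}}\sum_{A\cap B=x}m_1(A)m_2(B)$ for $x\neq\emptyset$. Open-world criterion: let $F_1,F_2$ be the sets of focal elements of $m_1,m_2$. The set of essential conflict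 elements $\Upsilon_{1,2}\subseteq\Theta_1\cup\Theta_2$ is the set of all $\omega$ for which there are $i\neq j$ in $\{1,2\}$ and $A\in F_i$ with $\omega\in A$ such that $A\cap B=\emptyset$ for all $B\in F_j$. The evidence combination of $m_1$ and $m_2$ satisfies the open-world criterion if $\Upsilon_{1,2}\neq\emptyset$. *)

theory Defs
  imports Complex_Main
begin

(* Subsets of frames are sets over one ambient type, so that two frames may overlap
   arbitrarily.  A mass function on \<Theta> is extended by zero to sets outside Pow \<Theta>. *)
definition mass_function :: "'a set \<Rightarrow> ('a set \<Rightarrow> real) \<Rightarrow> bool" where
  "mass_function \<Theta> m \<longleftrightarrow>
     finite \<Theta> \<and>
     (\<forall>A. A \<subseteq> \<Theta> \<longrightarrow> 0 \<le> m A \<and> m A \<le> 1) \<and>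
     (\<forall>A. \<not> A \<subseteq> \<Theta> \<longrightarrow> m A = 0) \<and>
     m {} = 0 \<and>
     (\<Sum>A\<in>Pow \<Theta>. m A) = 1"

definition focal_elements :: "'a set \<Rightarrow> ('a set \<Rightarrow> real) \<Rightarrow> 'a set set" where
  "focal_elements \<Theta> m = {A. A \<subseteq> \<Theta> \<and> m A > 0}"

definition plausibility :: "'a set \<Rightarrow> ('a set \<Rightarrow> real) \<Rightarrow> 'a set \<Rightarrow> real" where
  "plausibility \<Theta> m A = (\<Sum>B | B \<subseteq> \<Theta> \<and> B \<inter> A \<noteq> {}. m B)"

(* In the next two definitions \<Theta> is the common frame, i.e. the union of the two frames. *)
definition conflict :: "'a set \<Rightarrow> ('a set \<Rightarrow> real) \<Rightarrow> ('a set \<Rightarrow> real) \<Rightarrow> real" where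
  "conflict \<Theta> m1 m2 =
     (\<Sum>(A, B) | A \<subseteq> \<Theta> \<and> B \<subseteq> \<Theta> \<and> A \<inter> B = {}. m1 A * m2 B)"

definition dempster ::
  "'a set \<Rightarrow> ('a set \<Rightarrow> real) \<Rightarrow> ('a set \<Rightarrow> real) \<Rightarrow> 'a set \<Rightarrow> real" where
  "dempster \<Theta> m1 m2 X =
     (if X = {} then 0
      else 1 / (1 - conflict \<Theta> m1 m2) *
           (\<Sum>(A, B) | A \<subseteq> \<Theta> \<and> B \<subseteq> \<Theta> \<and> A \<inter> B = X. m1 A * m2 B))"

definition essential_conflict ::
  "'a set \<Rightarrow> 'a set \<Rightarrow> ('a set \<Rightarrow> real) \<Rightarrow> ('a set \<Rightarrow> real) \<Rightarrow> 'a set" where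
  "essential_conflict \<Theta>1 \<Theta>2 m1 m2 =
     {\<omega> \<in> \<Theta>1 \<union> \<Theta>2.
        (\<exists>A \<in> focal_elements \<Theta>1 m1. \<omega> \<in> A \<and> (\<forall>B \<in> focal_elements \<Theta>2 m2. A \<inter> B = {})) \<or>
        (\<exists>A \<in> focal_elements \<Theta>2 m2. \<omega> \<in> A \<and> (\<forall>B \<in> focal_elements \<Theta>1 m1. A \<inter> B = {}))}"

definition open_world_criterion ::
  "'a set \<Rightarrow> 'a set \<Rightarrow> ('a set \<Rightarrow> real) \<Rightarrow> ('a set \<Rightarrow> real) \<Rightarrow> bool" where
  "open_world_criterion \<Theta>1 \<Theta>2 m1 m2 \<longleftrightarrow> essential_conflict \<Theta>1 \<Theta>2 m1 m2 \<noteq> {}"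

end

(* If \<omega> lies in a focal element of one mass function that misses every focal element of the
   other, then the other gives no mass to any set containing \<omega>, so every product contributing
   to a combined mass of a set containing \<omega> vanishes. *)

theory Submission
  imports Defs
begin

lemma mass_function_nonneg: "0 \<le> m A" if "mass_function \<Theta> m"
  using that by (cases "A \<subseteq> \<Theta>") (auto simp: mass_function_def)

text \<open>Inside the frame nonnegativity leaves only the value 0; outside it the extension by zero
  applies. Hence later uses need not check that a set lies in the frame.\<close>

lemma mass_function_eq_0_if_not_focal:
  assumes "mass_function \<Theta> m" "A \<notin> focal_elements \<Theta> m"
  shows "m A = 0"
proof (cases "A \<subseteq> \<Theta>")
  case True
  then show ?thesis
    using assms(2) mass_function_nonneg[OF assms(1), of A] by (simp add: focal_elements_def)
next
  case False
  then show ?thesis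
    using assms(1) by (simp add: mass_function_def)
qed

text \<open>The summand at \<open>A\<close> is positive, and nonnegative masses cannot cancel
  it.\<close>

lemma plausibility_pos_if_focal:
  assumes "mass_function \<Theta> m" "A \<in> focal_elements \<Theta> m" "A \<inter> C \<noteq> {}"
  shows "0 < plausibility \<Theta> m C"
  unfolding plausibility_def
proof (rule sum_pos2[where i = A])
  show "finite {B. B \<subseteq> \<Theta> \<and> B \<inter> C \<noteq> {}}"
    using assms(1) by (simp add: mass_function_def)
qed (use assms in \<open>auto simp: focal_elements_def mass_function_nonneg[OF assms(1)]\<close>)

text \<open>The assumption speaks of products, so that either factor may be the one that vanishes;
  this covers both cases of the theorem.\<close>

lemma plausibility_dempster_eq_0:
  assumes "\<And>A B. \<omega> \<in> A \<Longrightarrow> \<omega> \<in> B \<Longrightarrow> m1 A * m2 B = 0"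
  shows "plausibility \<Theta> (dempster \<Theta> m1 m2) {\<omega>} = 0"
  unfolding plausibility_def
proof (rule sum.neutral, rule ballI)
  fix X
  assume "X \<in> {B. B \<subseteq> \<Theta> \<and> B \<inter> {\<omega>} \<noteq> {}}"
  then have "\<omega> \<in> X" by auto
  \<comment> \<open>From \<open>A \<inter> B = X\<close> and \<omega> in \<open>X\<close> it follows
    that \<omega> lies in both \<open>A\<close> and \<open>B\<close>, so the assumption kills each
    summand.\<close>
  then have "(\<Sum>(A, B) | A \<subseteq> \<Theta> \<and> B \<subseteq> \<Theta> \<and> A \<inter> B = X. m1 A * m2 B) = 0"
    using assms by (intro sum.neutral) auto
  then show "dempster \<Theta> m1 m2 X = 0"
    by (simp add: dempster_def)
qed

theorem theorem1:
  fixes \<Theta>1 \<Theta>2 :: "'a set" and m1 m2 :: "'a set \<Rightarrow> real"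
  assumes "mass_function \<Theta>1 m1"
    and "mass_function \<Theta>2 m2"
    and "conflict (\<Theta>1 \<union> \<Theta>2) m1 m2 < 1"
    and "open_world_criterion \<Theta>1 \<Theta>2 m1 m2"
  shows "\<exists>\<omega> \<in> \<Theta>1 \<union> \<Theta>2.
           (plausibility \<Theta>1 m1 {\<omega>} > 0 \<or> plausibility \<Theta>2 m2 {\<omega>} > 0) \<and>
           plausibility (\<Theta>1 \<union> \<Theta>2) (dempster (\<Theta>1 \<union> \<Theta>2) m1 m2) {\<omega>} = 0"
proof -
  \<comment> \<open>A set \<open>B\<close> containing \<omega> meets \<open>A\<close> in \<omega>,
    so it cannot be focal. The frame and mass function are kept general because the two cases below
    apply this to opposite sides.\<close>
  have no_mass: "m B = 0"
    if "mass_function \<Theta> m" "\<omega> \<in> A" "\<forall>B \<in> focal_elements \<Theta> m. A \<inter> B = {}" "\<omega> \<in> B"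
    for \<Theta> m A B and \<omega> :: 'a
    using that by (intro mass_function_eq_0_if_not_focal) auto
  obtain \<omega> where "\<omega> \<in> essential_conflict \<Theta>1 \<Theta>2 m1 m2"
    using assms(4) by (auto simp: open_world_criterion_def)
  then consider
      (left) A where "\<omega> \<in> \<Theta>1 \<union> \<Theta>2" "A \<in> focal_elements \<Theta>1 m1" "\<omega> \<in> A"
        "\<forall>B \<in> focal_elements \<Theta>2 m2. A \<inter> B = {}"
    | (right) A where "\<omega> \<in> \<Theta>1 \<union> \<Theta>2" "A \<in> focal_elements \<Theta>2 m2" "\<omega> \<in> A"
        "\<forall>B \<in> focal_elements \<Theta>1 m1. A \<inter> B = {}"
    unfolding essential_conflict_def by blast
  then show ?thesis
  proof cases
    case left
    \<comment> \<open>The focal set \<open>A\<close> that makes \<omega> an essential conflict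
      element is itself the set of positive mass meeting \<open>{\<omega>}\<close>.\<close>
    have "plausibility \<Theta>1 m1 {\<omega>} > 0"
      using left by (intro plausibility_pos_if_focal[OF assms(1)]) auto
    moreover have "plausibility (\<Theta>1 \<union> \<Theta>2) (dempster (\<Theta>1 \<union> \<Theta>2) m1 m2) {\<omega>} = 0"
      by (rule plausibility_dempster_eq_0) (simp add: no_mass[OF assms(2) left(3,4)])
    ultimately show ?thesis
      using left(1) by blast
  next
    case right
    have "plausibility \<Theta>2 m2 {\<omega>} > 0"
      using right by (intro plausibility_pos_if_focal[OF assms(2)]) auto
    \<comment> \<open>With the roles exchanged, it is now the factor from \<open>m1\<close> that
      vanishes.\<close>
    moreover have "plausibility (\<Theta>1 \<union> \<Theta>2) (dempster (\<Theta>1 \<union> \<Theta>2) m1 m2) {\<omega>} = 0"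
      by (rule plausibility_dempster_eq_0) (simp add: no_mass[OF assms(1) right(3,4)])
    ultimately show ?thesis
      using right(1) by blast
  qed
qed

end
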